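(* For every integer $k > 1$, $\mathrm{ATIME}[\log^k n, 2] \subsetneq \mathrm{ATIME}[\log^{k+1} n, 2]$.
   Context: Throughout, $\log n$ denotes $\log_2 n$ and $\log^k n$ denotes $(\log n)^k$. A random-access Turing machine is a multi-tape Turing machine with a read-only random-access input of length $n+1$ (the input binary string followed by an endmark $\triangleleft$), a fixed number of read-write working tapes, and a read-write input address-tape of length $\lceil\log n\rceil$; at each step the binary number on the address-tape determines which input cell is read (the endmark cell if the number exceeds $n$). A random-access alternating Turing machine is such a machine whose states are partitioned into existential and universal states, with the usual alternating acceptance condition. $\mathrm{ATIME}[f(n), m]$ is the class of languages of binary strings accepted by a random-access alternating Turing machine that starts in an existential state, makes at most $O(f(n))$ steps on inputs of length $n$, and whose computations have at most $m$ alternating blocks of existential/universal states (i.e. at most $m-1$ alternations), so that $\mathrm{ATIME}[f(n),1]$ coincides with non-deterministic time $O(f(n))$. *)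

theory Defs
  imports Complex_Main "HOL-Library.Landau_Symbols"
begin

datatype move = Move_Left | Stay | Move_Right

(* The written address bit and the written working-tape symbols all go to the cells
   scanned before the heads are moved. *)
record action =
  next_state :: nat
  addr_write :: bool
  addr_move :: move
  work_ops :: "(nat \<times> move) list"

(* States and working-tape symbols are natural numbers; this is no restriction since both
   sets are finite.  The symbols are 0, ..., num_symbols - 1, with 0 the blank.
   The arguments of delta are the current state, the scanned input cell (None is the endmark),
   the scanned address-tape cell (None if the head is just past the last cell), and the
   scanned symbols of the working tapes. *)
record ratm =
  ex_states :: "nat set"
  un_states :: "nat set"
  init_state :: nat
  accept_states :: "nat set"
  num_symbols :: nat
  num_tapes :: nat
  delta :: "nat \<Rightarrow> bool option \<Rightarrow> bool option \<Rightarrow> nat list \<Rightarrow> action set"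

definition states :: "ratm \<Rightarrow> nat set" where
  "states M = ex_states M \<union> un_states M"

definition valid_action :: "ratm \<Rightarrow> action \<Rightarrow> bool" where
  "valid_action M act \<longleftrightarrow>
     next_state act \<in> states M \<and>
     length (work_ops act) = num_tapes M \<and>
     (\<forall>(s, d) \<in> set (work_ops act). s < num_symbols M)"

definition random_access_ATM :: "ratm \<Rightarrow> bool" where
  "random_access_ATM M \<longleftrightarrow>
     finite (ex_states M) \<and> finite (un_states M) \<and> ex_states M \<inter> un_states M = {} \<and>
     init_state M \<in> states M \<and> accept_states M \<subseteq> states M \<and> 0 < num_symbols M \<and>
     (\<forall>q \<in> states M. \<forall>a b ws.
        length ws = num_tapes M \<longrightarrow> (\<forall>s \<in> set ws. s < num_symbols M) \<longrightarrow>
          (\<forall>act \<in> delta M q a b ws. valid_action M act)) \<and>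
     (\<forall>q \<in> accept_states M. \<forall>a b ws. delta M q a b ws = {})"

(* A working tape is two-way infinite and is stored together with its head position. *)
record config =
  state :: nat
  addr :: "bool list"
  addr_head :: nat
  work :: "((int \<Rightarrow> nat) \<times> int) list"

(* In HOL, log 2 0 = 0, so the address tape is empty for the empty input. *)
definition addr_length :: "nat \<Rightarrow> nat" where
  "addr_length n = nat \<lceil>log 2 (real n)\<rceil>"

definition init_config :: "ratm \<Rightarrow> bool list \<Rightarrow> config" where
  "init_config M x =
     \<lparr>state = init_state M,
      addr = replicate (addr_length (length x)) False,
      addr_head = 0,
      work = replicate (num_tapes M) (\<lambda>_. 0, 0)\<rparr>"

(* The leftmost address cell is the most significant bit; horner_sum is least significant first. *)
definition addr_value :: "config \<Rightarrow> nat" where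
  "addr_value c = horner_sum of_bool 2 (rev (addr c))"

(* Input cells are numbered from 0, so cell number n of an input of length n is the endmark. *)
definition scan_input :: "bool list \<Rightarrow> config \<Rightarrow> bool option" where
  "scan_input x c = (if addr_value c < length x then Some (x ! addr_value c) else None)"

definition scan_addr :: "config \<Rightarrow> bool option" where
  "scan_addr c = (if addr_head c < length (addr c) then Some (addr c ! addr_head c) else None)"

definition scan_work :: "config \<Rightarrow> nat list" where
  "scan_work c = map (\<lambda>(tp, h). tp h) (work c)"

(* The head stays within the positions 0, ..., len.  Position len is just past the last cell of
   the address tape: it lets the machine recognize the end of the tape, and a write there has
   no effect (list_update is the identity at an index out of range). *)
fun move_addr_head :: "nat \<Rightarrow> move \<Rightarrow> nat \<Rightarrow> nat" where
  "move_addr_head len Move_Left h = h - 1"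
| "move_addr_head len Stay h = h"
| "move_addr_head len Move_Right h = min len (h + 1)"

fun move_head :: "move \<Rightarrow> int \<Rightarrow> int" where
  "move_head Move_Left h = h - 1"
| "move_head Stay h = h"
| "move_head Move_Right h = h + 1"

definition apply_action :: "action \<Rightarrow> config \<Rightarrow> config" where
  "apply_action act c =
     \<lparr>state = next_state act,
      addr = (addr c)[addr_head c := addr_write act],
      addr_head = move_addr_head (length (addr c)) (addr_move act) (addr_head c),
      work = map2 (\<lambda>(tp, h) (s, d). (tp(h := s), move_head d h)) (work c) (work_ops act)\<rparr>"

definition successors :: "ratm \<Rightarrow> bool list \<Rightarrow> config \<Rightarrow> config set" where
  "successors M x c =
     (\<lambda>act. apply_action act c) ` delta M (state c) (scan_input x c) (scan_addr c) (scan_work c)"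

inductive accepting :: "ratm \<Rightarrow> bool list \<Rightarrow> config \<Rightarrow> bool" for M x where
  final: "state c \<in> accept_states M \<Longrightarrow> accepting M x c"
| existential: "state c \<in> ex_states M \<Longrightarrow> c' \<in> successors M x c \<Longrightarrow> accepting M x c' \<Longrightarrow>
    accepting M x c"
| universal: "state c \<in> un_states M \<Longrightarrow> successors M x c \<noteq> {} \<Longrightarrow>
    \<forall>c' \<in> successors M x c. accepting M x c' \<Longrightarrow> accepting M x c"

definition accepted_language :: "ratm \<Rightarrow> bool list set" where
  "accepted_language M = {x. accepting M x (init_config M x)}"

(* Computations need not be maximal: every finite initial part is included. *)
definition computation :: "ratm \<Rightarrow> bool list \<Rightarrow> config list \<Rightarrow> bool" where
  "computation M x cs \<longleftrightarrow>
     cs \<noteq> [] \<and> hd cs = init_config M x \<and> successively (\<lambda>c c'. c' \<in> successors M x c) cs"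

definition num_steps :: "config list \<Rightarrow> nat" where
  "num_steps cs = length cs - 1"

(* The number of maximal segments of consecutive configurations of the same kind. *)
definition num_blocks :: "ratm \<Rightarrow> config list \<Rightarrow> nat" where
  "num_blocks M cs = length (remdups_adj (map (\<lambda>c. state c \<in> ex_states M) cs))"

definition ATIME :: "(nat \<Rightarrow> real) \<Rightarrow> nat \<Rightarrow> bool list set set" where
  "ATIME f m =
     {L. \<exists>M t. random_access_ATM M \<and> init_state M \<in> ex_states M \<and>
            (\<lambda>n. real (t n)) \<in> O(f) \<and>
            (\<forall>x cs. computation M x cs \<longrightarrow>
               num_steps cs \<le> t (length x) \<and> num_blocks M cs \<le> m) \<and>
            accepted_language M = L}"

end

theory Submission
  imports Defs "HOL-Real_Asymp.Real_Asymp"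
begin

text \<open>The separating language is the threshold language: at least r = (l + 1) ^ k ones, where l is the
  length of the address tape.  A purely existential machine guesses r increasing addresses of ones,
  spending O(l) steps on each, with a counter of k digits in base l + 1 as a clock.

  For the lower bound, consider a machine with two blocks and time T = O(l ^ k).  For a fixed list w
  of actions of its existential phase, every input that w does not lead to acceptance has a
  rejection certificate of at most T + 1 cells, and every input with fewer than r ones is rejected.
  Branching over the cells of such certificates shows that w accepts at most (T + 1) ^ r inputs with
  exactly r ones.  There are 2 ^ O(T) lists w, whereas there are at least (n / r) ^ r inputs of length
  n with r ones; for n = 2 ^ l this is too many.\<close>

subsection \<open>Runs\<close>

definition enabled :: "ratm \<Rightarrow> bool list \<Rightarrow> config \<Rightarrow> action set" where
  "enabled M x c = delta M (state c) (scan_input x c) (scan_addr c) (scan_work c)"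

lemma successors_eq: "successors M x c = (\<lambda>a. apply_action a c) ` enabled M x c"
  by (simp add: successors_def enabled_def)

text \<open>\<open>Q\<close> is demanded only of configurations at which an action is taken, not of
  the last one. So a run with \<open>Q\<close> existential may end in the first universal
  configuration, which is how the existential phase is delimited.\<close>

primrec run :: "ratm \<Rightarrow> (config \<Rightarrow> bool) \<Rightarrow> bool list \<Rightarrow> config \<Rightarrow> action list \<Rightarrow> bool" where
  "run M Q x c [] \<longleftrightarrow> True"
| "run M Q x c (a # as) \<longleftrightarrow> Q c \<and> a \<in> enabled M x c \<and> run M Q x (apply_action a c) as"

primrec trace :: "config \<Rightarrow> action list \<Rightarrow> config list" where
  "trace c [] = [c]"
| "trace c (a # as) = c # trace (apply_action a c) as"

text \<open>The cell scanned by the last configuration counts as well: whether that configuration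
  has a successor depends on it too. This is why T actions may read T + 1 cells.\<close>

primrec reads :: "config \<Rightarrow> action list \<Rightarrow> nat set" where
  "reads c [] = {addr_value c}"
| "reads c (a # as) = insert (addr_value c) (reads (apply_action a c) as)"

lemma run_append:
  "run M Q x c (as @ bs) \<longleftrightarrow> run M Q x c as \<and> run M Q x (fold apply_action as c) bs"
  by (induction as arbitrary: c) auto

lemma run_mono: "run M Q x c as \<Longrightarrow> (\<And>c. Q c \<Longrightarrow> Q' c) \<Longrightarrow> run M Q' x c as"
  by (induction as arbitrary: c) auto

lemma trace_nonempty [simp]: "trace c as \<noteq> []"
  by (cases as) auto

lemma hd_trace [simp]: "hd (trace c as) = c"
  by (cases as) auto

lemma last_trace [simp]: "last (trace c as) = fold apply_action as c"
  by (induction as arbitrary: c) auto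

lemma length_trace [simp]: "length (trace c as) = Suc (length as)"
  by (induction as arbitrary: c) auto

lemma trace_snoc: "trace c (as @ [a]) = trace c as @ [apply_action a (fold apply_action as c)]"
  by (induction as arbitrary: c) auto

lemma finite_reads [simp]: "finite (reads c as)"
  by (induction as arbitrary: c) auto

lemma card_reads: "card (reads c as) \<le> Suc (length as)"
proof (induction as arbitrary: c)
  case (Cons a as)
  have "card (reads c (a # as)) \<le> Suc (card (reads (apply_action a c) as))"
    by (simp add: card_insert_if)
  with Cons [of "apply_action a c"] show ?case by simp
qed simp

lemma reads_append:
  "reads c as \<subseteq> reads c (as @ bs)" "reads (fold apply_action as c) bs \<subseteq> reads c (as @ bs)"
proof -
  have "addr_value c \<in> reads c bs" for c by (cases bs) auto
  then show "reads c as \<subseteq> reads c (as @ bs)"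
    by (induction as arbitrary: c) auto
  show "reads (fold apply_action as c) bs \<subseteq> reads c (as @ bs)"
    by (induction as arbitrary: c) auto
qed

lemma addr_value_last_read: "addr_value (fold apply_action as c) \<in> reads c as"
  by (induction as arbitrary: c) auto

text \<open>Addresses at or beyond the length need no condition: words of equal length both show the
  endmark there.\<close>

definition agree_on :: "nat set \<Rightarrow> bool list \<Rightarrow> bool list \<Rightarrow> bool" where
  "agree_on C x y \<longleftrightarrow> length x = length y \<and> (\<forall>i\<in>C. i < length x \<longrightarrow> x ! i = y ! i)"

lemma agree_on_subset: "agree_on C x y \<Longrightarrow> D \<subseteq> C \<Longrightarrow> agree_on D x y"
  by (auto simp: agree_on_def)

lemma enabled_cong: "agree_on C x y \<Longrightarrow> addr_value c \<in> C \<Longrightarrow> enabled M x c = enabled M y c"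
  by (auto simp: agree_on_def enabled_def scan_input_def)

text \<open>The configuration reached by a list of actions does not depend on the input, so a run
  is determined by the cells it reads.\<close>

lemma run_cong: "agree_on (reads c as) x y \<Longrightarrow> run M Q x c as = run M Q y c as"
proof (induction as arbitrary: c)
  case (Cons a as)
  then show ?case
    using enabled_cong [of "reads c (a # as)" x y c M]
      agree_on_subset [of "reads c (a # as)" x y "reads (apply_action a c) as"] by auto
qed simp

lemma run_computation:
  assumes "run M Q x (init_config M x) as"
  shows "computation M x (trace (init_config M x) as)"
proof -
  have "run M Q x c as \<Longrightarrow> successively (\<lambda>c c'. c' \<in> successors M x c) (trace c as)" for c
  proof (induction as arbitrary: c)
    case (Cons a as)
    then show ?case by (simp add: successively_Cons successors_eq)
  qed simp
  then show ?thesis using assms by (simp add: computation_def)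
qed

section \<open>Well-formed configurations and the finite set of actions\<close>

definition wf_config :: "ratm \<Rightarrow> config \<Rightarrow> bool" where
  "wf_config M c \<longleftrightarrow> state c \<in> states M \<and> length (work c) = num_tapes M \<and>
     (\<forall>(tp, h) \<in> set (work c). \<forall>i. tp i < num_symbols M)"

lemma wf_init: "random_access_ATM M \<Longrightarrow> wf_config M (init_config M x)"
  by (auto simp: random_access_ATM_def wf_config_def init_config_def)

lemma enabled_valid:
  assumes "random_access_ATM M" "wf_config M c" "a \<in> enabled M x c"
  shows "valid_action M a"
proof -
  have "length (scan_work c) = num_tapes M" "\<forall>s \<in> set (scan_work c). s < num_symbols M"
    using assms(2) by (auto simp: wf_config_def scan_work_def)
  then show ?thesis
    using assms unfolding random_access_ATM_def wf_config_def enabled_def by blast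
qed

lemma wf_step:
  assumes "random_access_ATM M" "wf_config M c" "a \<in> enabled M x c"
  shows "wf_config M (apply_action a c)"
proof -
  have a: "next_state a \<in> states M" "length (work_ops a) = num_tapes M"
      "\<And>s d. (s, d) \<in> set (work_ops a) \<Longrightarrow> s < num_symbols M"
    using enabled_valid [OF assms] by (auto simp: valid_action_def)
  have c: "length (work c) = num_tapes M"
      "\<And>tp h i. (tp, h) \<in> set (work c) \<Longrightarrow> tp i < num_symbols M"
    using assms(2) by (auto simp: wf_config_def)
  have "tp i < num_symbols M" if "(tp, h) \<in> set (work (apply_action a c))" for tp h i
  proof -
    from that obtain tp' h' s d where z: "((tp', h'), (s, d)) \<in> set (zip (work c) (work_ops a))"
        and tp: "tp = tp'(h' := s)"
      by (auto simp: apply_action_def)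
    from z have "(tp', h') \<in> set (work c)" "(s, d) \<in> set (work_ops a)"
      by (rule set_zip_leftD, rule set_zip_rightD)
    with tp a(3) c(2) show ?thesis by auto
  qed
  moreover have "state (apply_action a c) \<in> states M"
      "length (work (apply_action a c)) = num_tapes M"
    using a c by (auto simp: apply_action_def)
  ultimately show ?thesis unfolding wf_config_def by blast
qed

lemma run_wf:
  assumes "random_access_ATM M" "wf_config M c" "run M Q x c as"
  shows "wf_config M (fold apply_action as c)"
  using assms(2,3) by (induction as arbitrary: c) (auto intro: wf_step [OF assms(1)])

lemma run_valid_actions:
  assumes "random_access_ATM M" "wf_config M c" "run M Q x c as"
  shows "set as \<subseteq> Collect (valid_action M)"
  using assms(2,3)
  by (induction as arbitrary: c)
    (auto intro: wf_step [OF assms(1)] enabled_valid [OF assms(1)])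

text \<open>This provides the finite alphabet over which existential phases are counted:
  \<open>delta\<close> is an arbitrary function, but from well-formed configurations it yields only
  valid actions.\<close>

lemma finite_valid_actions:
  assumes "random_access_ATM M"
  shows "finite (Collect (valid_action M))"
proof -
  define W where "W = {xs. set xs \<subseteq> {..<num_symbols M} \<times> {Move_Left, Stay, Move_Right} \<and>
    length xs = num_tapes M}"
  have "finite W"
    unfolding W_def by (intro finite_lists_length_eq) auto
  moreover have "finite (states M)"
    using assms by (auto simp: random_access_ATM_def states_def)
  ultimately have "finite (states M \<times> (UNIV :: bool set) \<times> {Move_Left, Stay, Move_Right} \<times> W)"
    by (intro finite_cartesian_product) auto
  moreover have "Collect (valid_action M) \<subseteq>
      (\<lambda>(q, b, d, w). \<lparr>next_state = q, addr_write = b, addr_move = d, work_ops = w\<rparr>) `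
        (states M \<times> (UNIV :: bool set) \<times> {Move_Left, Stay, Move_Right} \<times> W)"
  proof
    fix a assume "a \<in> Collect (valid_action M)"
    moreover have "d \<in> {Move_Left, Stay, Move_Right}" for d by (cases d) auto
    ultimately have "(next_state a, addr_write a, addr_move a, work_ops a) \<in>
        states M \<times> UNIV \<times> {Move_Left, Stay, Move_Right} \<times> W"
      by (auto simp: W_def valid_action_def)
    then show "a \<in> (\<lambda>(q, b, d, w). \<lparr>next_state = q, addr_write = b, addr_move = d, work_ops = w\<rparr>) `
        (states M \<times> (UNIV :: bool set) \<times> {Move_Left, Stay, Move_Right} \<times> W)"
      by (rule rev_image_eqI) simp
  qed
  ultimately show ?thesis
    by (rule finite_surj)
qed

lemma card_lists_length_le_power:
  assumes "finite A"
  shows "card {xs. set xs \<subseteq> A \<and> length xs \<le> n} \<le> (card A + 1) ^ n"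
proof -
  have "(\<Sum>i\<le>n. a ^ i) \<le> (a + 1) ^ n" for a :: nat
  proof (induction n)
    case (Suc n)
    have "(\<Sum>i\<le>Suc n. a ^ i) = (\<Sum>i\<le>n. a ^ i) + a ^ Suc n" by simp
    also have "\<dots> \<le> (a + 1) ^ n + a * (a + 1) ^ n"
      by (intro add_mono Suc) (simp add: power_mono)
    finally show ?case by simp
  qed simp
  then show ?thesis
    by (simp only: card_lists_length_le [OF assms])
qed

subsection \<open>Rejection certificates\<close>

locale two_block_machine =
  fixes M :: ratm and T :: nat and n :: nat
  assumes machine: "random_access_ATM M" and init_ex: "init_state M \<in> ex_states M"
    and steps: "\<And>x cs. length x = n \<Longrightarrow> computation M x cs \<Longrightarrow> num_steps cs \<le> T"
    and blocks: "\<And>x cs. length x = n \<Longrightarrow> computation M x cs \<Longrightarrow> num_blocks M cs \<le> 2"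
begin

text \<open>The initial configuration depends on the input only through its length, so one word
  serves as representative, and the same action list can be run on all inputs of length
  \<open>n\<close>.\<close>

definition start :: config where
  "start = init_config M (replicate n False)"

lemma start_eq: "length x = n \<Longrightarrow> init_config M x = start"
  by (simp add: start_def init_config_def)

lemma wf_start: "wf_config M start"
  unfolding start_def by (rule wf_init [OF machine])

lemma run_length:
  assumes "length x = n" "run M Q x start as"
  shows "length as \<le> T"
  using steps [OF assms(1) run_computation [of M Q x as]] assms
  by (simp add: start_eq num_steps_def)

abbreviation existential_state :: "config \<Rightarrow> bool" where
  "existential_state c \<equiv> state c \<in> ex_states M"

abbreviation any_state :: "config \<Rightarrow> bool" where
  "any_state c \<equiv> True"

text \<open>The computation starts existential; a return from a universal to an existential
  configuration would open a third block.\<close>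

lemma universal_stays:
  assumes x: "length x = n" and run: "run M Q x start as" and a: "a \<in> enabled M x (fold apply_action as start)"
    and un: "\<not> existential_state (fold apply_action as start)"
  shows "\<not> existential_state (apply_action a (fold apply_action as start))"
proof
  assume ex: "existential_state (apply_action a (fold apply_action as start))"
  let ?kinds = "map existential_state (trace start as)"
  let ?f = "\<lambda>as. map existential_state (trace start as)"
  have "run M any_state x start (as @ [a])"
    using run a by (auto simp: run_append intro: run_mono)
  then have "computation M x (trace start (as @ [a]))"
    using run_computation [of M _ x] x by (simp add: start_eq)
  from blocks [OF x this] have *: "length (remdups_adj (?f (as @ [a]))) \<le> 2"
    by (simp add: num_blocks_def)
  obtain ks where ks: "?kinds = ks @ [False]"
  proof -
    have "?kinds \<noteq> []" "last ?kinds = False"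
      using un by (auto simp: last_map)
    then show thesis
      by (metis that append_butlast_last_id)
  qed
  have "hd ?kinds = True"
    using init_ex by (simp add: hd_map start_def init_config_def)
  moreover have "hd ?kinds \<in> set ?kinds"
    by (rule hd_in_set) simp
  ultimately have "True \<in> set ?kinds" by (simp only:)
  moreover have "False \<in> set ?kinds" using ks by simp
  ultimately have "{True, False} \<subseteq> set (remdups_adj ?kinds)" by (simp only: remdups_adj_set) blast
  then have "card {True, False} \<le> length (remdups_adj ?kinds)"
    by (meson List.finite_set card_length card_mono le_trans)
  then have "2 \<le> length (remdups_adj (ks @ [False]))"
    unfolding ks by simp
  moreover have "?f (as @ [a]) = ks @ [False, True]"
    using ks ex by (simp add: trace_snoc)
  then have "remdups_adj (?f (as @ [a])) = remdups_adj (ks @ [False]) @ [True]"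
    by (simp add: remdups_adj_append_two)
  ultimately show False using * by simp
qed

text \<open>The list \<open>w\<close> is a complete existential phase: it stops at an accepting
  state or on leaving the existential states.\<close>

definition witnessed :: "action list \<Rightarrow> bool list \<Rightarrow> bool" where
  "witnessed w x \<longleftrightarrow> run M existential_state x start w \<and>
     accepting M x (fold apply_action w start) \<and>
     (existential_state (fold apply_action w start) \<longrightarrow>
        state (fold apply_action w start) \<in> accept_states M)"

text \<open>Follow the accepting derivation and record the chosen actions until it uses a rule other
  than \<open>existential\<close>.\<close>

lemma accepting_imp_run:
  assumes "accepting M x c"
  shows "\<exists>w. run M existential_state x c w \<and> accepting M x (fold apply_action w c) \<and>
     (existential_state (fold apply_action w c) \<longrightarrow> state (fold apply_action w c) \<in> accept_states M)"
  using assms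
proof induction
  case (final c)
  then show ?case by (intro exI [of _ "[]"]) (auto intro: accepting.final)
next
  case (existential c c')
  then obtain a w where "a \<in> enabled M x c" "c' = apply_action a c"
    "run M existential_state x c' w \<and> accepting M x (fold apply_action w c') \<and>
     (existential_state (fold apply_action w c') \<longrightarrow> state (fold apply_action w c') \<in> accept_states M)"
    by (auto simp: successors_eq)
  with existential(1) show ?case by (intro exI [of _ "a # w"]) auto
next
  case (universal c)
  have "c \<notin> {c. existential_state c}"
    using universal(1) machine by (auto simp: random_access_ATM_def)
  moreover have "accepting M x c"
    using universal by (blast intro: accepting.universal)
  ultimately show ?case by (intro exI [of _ "[]"]) auto
qed

lemma run_accepting:
  assumes "run M existential_state x c w" "accepting M x (fold apply_action w c)"
  shows "accepting M x c"
  using assms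
proof (induction w arbitrary: c)
  case (Cons a w)
  then show ?case
    using accepting.existential [of c M "apply_action a c" x] by (simp add: successors_eq)
qed simp

lemma accepted_iff_witnessed:
  assumes "length x = n"
  shows "x \<in> accepted_language M \<longleftrightarrow> (\<exists>w. witnessed w x)"
  using assms accepting_imp_run [of x start] run_accepting [of x start]
  by (auto simp: accepted_language_def start_eq witnessed_def)

text \<open>Since the second block is universal, a rejection after the existential phase is due to a
  single run into a non-accepting configuration without successors.\<close>

lemma rejecting_run:
  assumes "length x = n" "run M any_state x start v"
    "\<not> existential_state (fold apply_action v start)" "\<not> accepting M x (fold apply_action v start)"
  shows "\<exists>u. run M (\<lambda>c. \<not> existential_state c) x (fold apply_action v start) u \<and>
    run M any_state x start (v @ u) \<and>
    \<not> existential_state (fold apply_action (v @ u) start) \<and>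
    state (fold apply_action (v @ u) start) \<notin> accept_states M \<and>
    enabled M x (fold apply_action (v @ u) start) = {}"
  using assms(2-)
\<comment> \<open>The measure is the time left. The run from \<open>start\<close> is kept in the
  induction because the time bound and \<open>universal_stays\<close> speak of runs from
  there.\<close>
proof (induction "T - length v" arbitrary: v rule: less_induct)
  case less
  let ?c = "fold apply_action v start"
  have "state ?c \<in> un_states M"
    using run_wf [OF machine wf_start less.prems(1)] less.prems(2)
    by (auto simp: wf_config_def states_def)
  then consider "enabled M x ?c = {}" | a where "a \<in> enabled M x ?c" "\<not> accepting M x (apply_action a ?c)"
    using less.prems(3) accepting.universal [of ?c M x] by (auto simp: successors_eq)
  then show ?case
  proof cases
    case 1
    then show ?thesis
      using less.prems accepting.final [of ?c M x] by (intro exI [of _ "[]"]) auto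
  next
    case 2
    have r: "run M any_state x start (v @ [a])"
      using less.prems 2 by (simp add: run_append)
    have "T - length (v @ [a]) < T - length v"
      using run_length [OF assms(1) r] by auto
    moreover have "\<not> existential_state (fold apply_action (v @ [a]) start)"
      using universal_stays [OF assms(1) less.prems(1) 2(1)] less.prems(2) by simp
    ultimately obtain u where u: "run M (\<lambda>c. \<not> existential_state c) x (fold apply_action (v @ [a]) start) u"
      "run M any_state x start ((v @ [a]) @ u)"
      "\<not> existential_state (fold apply_action ((v @ [a]) @ u) start)"
      "state (fold apply_action ((v @ [a]) @ u) start) \<notin> accept_states M"
      "enabled M x (fold apply_action ((v @ [a]) @ u) start) = {}"
      using less.hyps [of "v @ [a]"] r 2(2) by auto
    then show ?thesis
      using 2(1) less.prems(2) by (intro exI [of _ "a # u"]) auto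
  qed
qed

text \<open>Rejection travels backwards: a universal configuration with one rejecting successor
  rejects. This serves to transfer a rejecting run to another input on which the same run
  exists.\<close>

lemma rejecting_run_not_accepting:
  assumes "run M (\<lambda>c. \<not> existential_state c) x c u"
    "\<not> existential_state (fold apply_action u c)"
    "state (fold apply_action u c) \<notin> accept_states M" "enabled M x (fold apply_action u c) = {}"
  shows "\<not> accepting M x c"
  using assms
proof (induction u arbitrary: c)
  case Nil
  show ?case
  proof
    assume "accepting M x c"
    then show False by cases (use Nil in \<open>auto simp: successors_eq\<close>)
  qed
next
  case (Cons a u)
  then have na: "\<not> accepting M x (apply_action a c)" and a: "a \<in> enabled M x c"
    and ne: "\<not> existential_state c" by auto
  show ?case
  proof
    assume "accepting M x c"
    then show False
    proof cases
      \<comment> \<open>Accepting states have no successors, yet \<open>a\<close> is enabled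
        here.\<close>
      case final
      then have "state c \<in> states M" using machine by (auto simp: random_access_ATM_def)
      with final have "enabled M x c = {}"
        using machine by (simp add: random_access_ATM_def enabled_def)
      with a show False by simp
    qed (use na a ne in \<open>auto simp: successors_eq\<close>)
  qed
qed

text \<open>There are three ways for \<open>w\<close> to fail: it is no existential run on
  \<open>y\<close>; it stops unfinished in an existential state, which no input can change; or the
  universal part has a rejecting run. In the first and the third case the cells read form the
  certificate.\<close>

lemma rejection_certificate:
  assumes y: "length y = n" and w: "length w \<le> T" and "\<not> witnessed w y"
  shows "\<exists>C. finite C \<and> card C \<le> T + 1 \<and> (\<forall>z. agree_on C y z \<longrightarrow> \<not> witnessed w z)"
proof -
  let ?c = "fold apply_action w start"
  consider (invalid) "\<not> run M existential_state y start w"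
    | (stuck) "existential_state ?c" "state ?c \<notin> accept_states M"
    | (rejected) "run M existential_state y start w" "\<not> existential_state ?c" "\<not> accepting M y ?c"
    using assms(3) accepting.final unfolding witnessed_def by blast
  then show ?thesis
  proof cases
    case invalid
    then have "\<not> witnessed w z" if "agree_on (reads start w) y z" for z
      using run_cong [OF that] by (simp add: witnessed_def)
    moreover have "card (reads start w) \<le> T + 1"
      using card_reads [of start w] w by simp
    ultimately show ?thesis by (intro exI [of _ "reads start w"]) simp
  next
    case stuck
    then have "\<not> witnessed w z" for z by (simp add: witnessed_def)
    then show ?thesis by (intro exI [of _ "{}"]) simp
  next
    case rejected
    have "run M any_state y start w"
      using rejected(1) by (rule run_mono) simp
    then obtain u where u: "run M (\<lambda>c. \<not> existential_state c) y ?c u"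
        "run M any_state y start (w @ u)"
        "\<not> existential_state (fold apply_action (w @ u) start)"
        "state (fold apply_action (w @ u) start) \<notin> accept_states M"
        "enabled M y (fold apply_action (w @ u) start) = {}"
      using rejecting_run [OF y _ rejected(2,3)] by blast
    let ?C = "reads start (w @ u)"
    have "\<not> witnessed w z" if z: "agree_on ?C y z" for z
    proof -
      have "run M (\<lambda>c. \<not> existential_state c) z ?c u"
        using u(1) run_cong [OF agree_on_subset [OF z reads_append(2)]] by blast
      moreover have "enabled M z (fold apply_action (w @ u) start) = {}"
        using u(5) enabled_cong [OF z addr_value_last_read] by blast
      ultimately have "\<not> accepting M z ?c"
        using u(3,4) by (intro rejecting_run_not_accepting [of z ?c u]) auto
      then show ?thesis by (simp add: witnessed_def)
    qed
    moreover have "card ?C \<le> T + 1"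
      using card_reads [of start "w @ u"] run_length [OF y u(2)] by simp
    ultimately show ?thesis by (intro exI [of _ ?C]) simp
  qed
qed

end

text \<open>An accepted superset of a rejected set p meets the certificate of p outside p, so there are at
  most t ways to add an element to p.\<close>

lemma card_accepted_supersets:
  fixes F :: "'a set \<Rightarrow> bool"
  assumes U: "finite U"
    and cert: "\<And>Y. Y \<subseteq> U \<Longrightarrow> \<not> F Y \<Longrightarrow>
      \<exists>C. finite C \<and> card C \<le> t \<and> (\<forall>Z\<subseteq>U. Z \<inter> C = Y \<inter> C \<longrightarrow> \<not> F Z)"
    and small: "\<And>Y. Y \<subseteq> U \<Longrightarrow> card Y < r \<Longrightarrow> \<not> F Y"
    and p: "p \<subseteq> U" "card p \<le> r"
  shows "card {X. p \<subseteq> X \<and> X \<subseteq> U \<and> card X = r \<and> F X} \<le> t ^ (r - card p)"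
  using p
\<comment> \<open>The induction is on the number of elements still missing from
  \<open>p\<close>.\<close>
proof (induction "r - card p" arbitrary: p)
  case 0
  then have "card p = r" by simp
  have "{X. p \<subseteq> X \<and> X \<subseteq> U \<and> card X = r \<and> F X} \<subseteq> {p}"
    using \<open>card p = r\<close> U card_subset_eq [of _ p] finite_subset [of _ U] by blast
  from card_mono [OF _ this] 0 show ?case by simp
next
  case (Suc d)
  then have "card p < r" by simp
  with small Suc.prems cert obtain C where C: "finite C" "card C \<le> t"
    "\<forall>Z\<subseteq>U. Z \<inter> C = p \<inter> C \<longrightarrow> \<not> F Z" by meson
  let ?S = "\<lambda>p. {X. p \<subseteq> X \<and> X \<subseteq> U \<and> card X = r \<and> F X}"
  have fin: "finite (?S p)" for p using U by simp
  have "?S p \<subseteq> (\<Union>i\<in>(C \<inter> U) - p. ?S (insert i p))"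
  proof
    fix X assume X: "X \<in> ?S p"
    then have "X \<inter> C \<noteq> p \<inter> C" using C by auto
    with X show "X \<in> (\<Union>i\<in>(C \<inter> U) - p. ?S (insert i p))" by auto
  qed
  then have "card (?S p) \<le> card (\<Union>i\<in>(C \<inter> U) - p. ?S (insert i p))"
    using C(1) fin by (intro card_mono) auto
  also have "\<dots> \<le> (\<Sum>i\<in>(C \<inter> U) - p. card (?S (insert i p)))"
    using C(1) by (intro card_UN_le) auto
  also have "\<dots> \<le> (\<Sum>i\<in>(C \<inter> U) - p. t ^ d)"
  proof (rule sum_mono)
    fix i assume i: "i \<in> (C \<inter> U) - p"
    have "finite p" using U Suc.prems finite_subset by blast
    with i have c: "card (insert i p) = Suc (card p)" by simp
    then have "d = r - card (insert i p)" using Suc.hyps(2) by simp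
    with Suc.hyps(1) [of "insert i p"] show "card (?S (insert i p)) \<le> t ^ d"
      using i Suc.prems c \<open>card p < r\<close> by auto
  qed
  also have "\<dots> \<le> card C * t ^ d"
    using C(1) card_mono [of C "(C \<inter> U) - p"] by (simp add: mult_le_mono1 subset_iff)
  also have "\<dots> \<le> t ^ Suc d" using C(2) by simp
  finally show ?case using Suc.hyps(2) by simp
qed

section \<open>Counting the accepted words with exactly r ones\<close>

definition indicator_word :: "nat \<Rightarrow> nat set \<Rightarrow> bool list" where
  "indicator_word n X = map (\<lambda>i. i \<in> X) [0..<n]"

lemma indicator_word_simps [simp]:
  "length (indicator_word n X) = n" "i < n \<Longrightarrow> indicator_word n X ! i \<longleftrightarrow> i \<in> X"
  by (simp_all add: indicator_word_def)

text \<open>Every word with \<open>r\<close> ones is witnessed by some \<open>w\<close>, which gives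
  a union bound over all \<open>w\<close>. Words with fewer ones are rejected, hence witnessed by no
  \<open>w\<close>; this is the smallness hypothesis of
  \<open>card_accepted_supersets\<close>.\<close>

lemma (in two_block_machine) threshold_bound:
  assumes acc: "\<And>X. X \<subseteq> {..<n} \<Longrightarrow> indicator_word n X \<in> accepted_language M \<longleftrightarrow> r \<le> card X"
  shows "n choose r \<le> (card (Collect (valid_action M)) + 1) ^ T * (T + 1) ^ r"
proof -
  let ?W = "{w. set w \<subseteq> Collect (valid_action M) \<and> length w \<le> T}"
  let ?S = "\<lambda>w. {X. {} \<subseteq> X \<and> X \<subseteq> {..<n} \<and> card X = r \<and> witnessed w (indicator_word n X)}"
  have finW: "finite ?W"
    using finite_valid_actions [OF machine] by (rule finite_lists_length_le)
  have "{X. X \<subseteq> {..<n} \<and> card X = r} \<subseteq> (\<Union>w\<in>?W. ?S w)"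
  proof
    fix X assume X: "X \<in> {X. X \<subseteq> {..<n} \<and> card X = r}"
    then obtain w where w: "witnessed w (indicator_word n X)"
      using acc [of X] accepted_iff_witnessed [of "indicator_word n X"] by auto
    then have "w \<in> ?W"
      using run_valid_actions [OF machine wf_start] run_length [of "indicator_word n X"]
      by (auto simp: witnessed_def)
    with X w show "X \<in> (\<Union>w\<in>?W. ?S w)" by blast
  qed
  moreover have "finite (\<Union>w\<in>?W. ?S w)"
    by (rule finite_subset [of _ "Pow {..<n}"]) auto
  ultimately have "card {X. X \<subseteq> {..<n} \<and> card X = r} \<le> card (\<Union>w\<in>?W. ?S w)"
    by (rule card_mono [rotated])
  also have "\<dots> \<le> (\<Sum>w\<in>?W. card (?S w))"
    by (rule card_UN_le [OF finW])
  also have "\<dots> \<le> (\<Sum>w\<in>?W. (T + 1) ^ r)"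
  proof (rule sum_mono)
    fix w assume w: "w \<in> ?W"
    have "card (?S w) \<le> (T + 1) ^ (r - card ({} :: nat set))"
    proof (rule card_accepted_supersets [where F = "\<lambda>X. witnessed w (indicator_word n X)"])
      fix Y assume Y: "Y \<subseteq> {..<n}" "\<not> witnessed w (indicator_word n Y)"
      then obtain C where C: "finite C" "card C \<le> T + 1"
        "\<And>z. agree_on C (indicator_word n Y) z \<Longrightarrow> \<not> witnessed w z"
        using rejection_certificate [of "indicator_word n Y" w] w by auto
      moreover have "agree_on C (indicator_word n Y) (indicator_word n Z)" if "Z \<inter> C = Y \<inter> C" for Z
        using that by (auto simp: agree_on_def)
      ultimately show "\<exists>C. finite C \<and> card C \<le> T + 1 \<and>
          (\<forall>Z\<subseteq>{..<n}. Z \<inter> C = Y \<inter> C \<longrightarrow> \<not> witnessed w (indicator_word n Z))"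
        by blast
    next
      fix Y assume "Y \<subseteq> {..<n}" "card Y < r"
      then show "\<not> witnessed w (indicator_word n Y)"
        using acc [of Y] accepted_iff_witnessed [of "indicator_word n Y"] by auto
    qed auto
    then show "card (?S w) \<le> (T + 1) ^ r" by simp
  qed
  also have "\<dots> \<le> (card (Collect (valid_action M)) + 1) ^ T * (T + 1) ^ r"
    using card_lists_length_le_power [OF finite_valid_actions [OF machine], of T] by simp
  also have "card {X. X \<subseteq> {..<n} \<and> card X = r} = n choose r"
    using n_subsets [of "{..<n}" r] by simp
  finally show ?thesis .
qed

subsection \<open>A machine for the threshold language\<close>

definition ones_from :: "bool list \<Rightarrow> nat \<Rightarrow> nat" where
  "ones_from x a = card {i. a \<le> i \<and> i < length x \<and> x ! i}"

text \<open>Take \<open>j\<close> to be the first one at or after \<open>a\<close>. Read as a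
  recursion, this is one round of the machine: guess \<open>j\<close>, then look for
  \<open>m\<close> more ones behind it.\<close>

lemma Suc_le_ones_from:
  "Suc m \<le> ones_from x a \<longleftrightarrow> (\<exists>j\<ge>a. j < length x \<and> x ! j \<and> m \<le> ones_from x (Suc j))"
proof
  let ?S = "\<lambda>a. {i. a \<le> i \<and> i < length x \<and> x ! i}"
  have fin: "finite (?S a)" for a by simp
  assume *: "Suc m \<le> ones_from x a"
  then have "?S a \<noteq> {}" unfolding ones_from_def by force
  define j where "j = Min (?S a)"
  have j: "j \<in> ?S a"
    unfolding j_def using fin \<open>?S a \<noteq> {}\<close> by (rule Min_in)
  have "?S a \<subseteq> insert j (?S (Suc j))"
  proof
    fix i assume i: "i \<in> ?S a"
    have "j \<le> i" unfolding j_def using fin i by (rule Min_le)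
    with i show "i \<in> insert j (?S (Suc j))" by auto
  qed
  from card_mono [OF _ this] have "card (?S a) \<le> Suc (card (?S (Suc j)))"
    using fin by (simp add: card_insert_if split: if_splits)
  with * j show "\<exists>j\<ge>a. j < length x \<and> x ! j \<and> m \<le> ones_from x (Suc j)"
    unfolding ones_from_def by (intro exI [of _ j]) simp
next
  assume "\<exists>j\<ge>a. j < length x \<and> x ! j \<and> m \<le> ones_from x (Suc j)"
  then obtain j where j: "a \<le> j" "j < length x" "x ! j" "m \<le> ones_from x (Suc j)" by blast
  have "Suc (ones_from x (Suc j)) = card (insert j {i. Suc j \<le> i \<and> i < length x \<and> x ! i})"
    unfolding ones_from_def by simp
  also have "\<dots> \<le> ones_from x a"
    unfolding ones_from_def using j by (intro card_mono) auto
  finally show "Suc m \<le> ones_from x a" using j(4) by simp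
qed

abbreviation bits_value :: "bool list \<Rightarrow> nat" where
  "bits_value bs \<equiv> horner_sum of_bool 2 (rev bs)"

lemma bits_value_less: "bits_value bs < 2 ^ length bs"
  using horner_sum_of_bool_2_less [of "rev bs"] by simp

lemma ex_bits_value:
  assumes "a < 2 ^ l"
  shows "\<exists>bs. length bs = l \<and> bits_value bs = a"
  using assms
  by (intro exI [of _ "rev (map (bit a) [0..<l])"])
    (simp add: horner_sum_bit_eq_take_bit take_bit_nat_eq_self)

text \<open>With the most significant bit first, the first difference decides. This lets a sweep
  from left to right compare the guess with the old address bit by bit.\<close>

lemma bits_value_less_if_prefix:
  assumes "length bs = length cs" "h < length bs" "take h bs = take h cs" "\<not> bs ! h" "cs ! h"
  shows "bits_value bs < bits_value cs"
proof -
  have bs: "bs = take h bs @ False # drop (Suc h) bs" and cs: "cs = take h cs @ True # drop (Suc h) cs"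
    using assms id_take_nth_drop [of h bs] id_take_nth_drop [of h cs] by auto
  show ?thesis
    using bits_value_less [of "drop (Suc h) bs"] assms(1,3)
    by (subst bs, subst cs) (simp add: horner_sum_append)
qed

text \<open>Every input cell therefore has an address on the tape.\<close>

lemma le_two_power_addr_length: "n \<le> 2 ^ addr_length n"
proof (cases "n = 0")
  case False
  have "log 2 (real n) \<le> real (addr_length n)"
    unfolding addr_length_def by linarith
  then have "real n \<le> 2 powr real (addr_length n)"
    using False by (simp add: log_le_iff)
  then have "real n \<le> real (2 ^ addr_length n)"
    by (simp add: powr_realpow)
  then show ?thesis by (simp only: of_nat_le_iff)
qed simp

text \<open>Tape 0 follows the address head; the heads of tapes 1 to k are the digits, least
  significant first, of a counter in base (address length + 1).  The only mark is in cell 0 of every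
  tape.  The state sweep d g guesses the bits of the next address from left to right: tapes 1 to
  d are being reset to the largest digit, and g tells whether the guess already exceeds the old
  address, whose remaining bits are still on the address tape.\<close>

definition sweep :: "nat \<Rightarrow> bool \<Rightarrow> nat" where
  "sweep d g = 3 + (2 * d + of_bool g)"

definition sweep_action :: "nat \<Rightarrow> nat \<Rightarrow> bool \<Rightarrow> move \<Rightarrow> (nat \<Rightarrow> nat) \<Rightarrow> (nat \<Rightarrow> move) \<Rightarrow> action" where
  "sweep_action k q b m s f =
     \<lparr>next_state = q, addr_write = b, addr_move = m,
      work_ops = map (\<lambda>i. (s i, f i)) [0..<Suc k]\<rparr>"

text \<open>State 0 writes the marks and starts a sweep that sets every digit to the maximum, with
  no lower bound on the guess; state 1 accepts. State 2 brings the address head back to the mark on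
  tape 0 and then decrements: a blank under the head of a digit means that the digit is non-zero,
  the lowest such digit \<open>d\<close> loses one, and the next sweep refills the digits below it.
  As each step must write an address bit, state 2 writes back what it scans. A sweep may not lower a
  bit until the guess exceeds the old address; past the last cell it requires a larger guess that
  points to a one.\<close>

definition threshold_delta :: "nat \<Rightarrow> nat \<Rightarrow> bool option \<Rightarrow> bool option \<Rightarrow> nat list \<Rightarrow> action set" where
  "threshold_delta k q a b ws =
    (if q = 0 then {sweep_action k (sweep k True) False Stay (\<lambda>_. 1) (\<lambda>_. Stay)}
     else if q = 1 then {}
     else if q = 2 then
       (if ws ! 0 = 0 then
          {sweep_action k 2 (b = Some True) Move_Left (nth ws) (\<lambda>i. if i = 0 then Move_Left else Stay)}
        else if \<forall>i<k. ws ! Suc i \<noteq> 0 then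
          {sweep_action k 1 (b = Some True) Stay (nth ws) (\<lambda>_. Stay)}
        else let d = (LEAST d. ws ! Suc d = 0) in
          {sweep_action k (sweep d False) (b = Some True) Stay (nth ws)
             (\<lambda>i. if i = Suc d then Move_Left else Stay)})
     else let d = (q - 3) div 2; g = odd (q - 3) in
       (case b of
          None \<Rightarrow> if g \<and> a = Some True then {sweep_action k 2 False Stay (nth ws) (\<lambda>_. Stay)} else {}
        | Some p \<Rightarrow>
            (\<lambda>r. sweep_action k (sweep d (g \<or> \<not> p \<and> r)) r Move_Right (nth ws)
               (\<lambda>i. if i \<le> d then Move_Right else Stay)) ` {r. g \<or> p \<le> r}))"

definition threshold_machine :: "nat \<Rightarrow> ratm" where
  "threshold_machine k =
     \<lparr>ex_states = {..<2 * k + 5}, un_states = {}, init_state = 0, accept_states = {1},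
      num_symbols = 2, num_tapes = Suc k, delta = threshold_delta k\<rparr>"

lemma threshold_machine_simps [simp]:
  "ex_states (threshold_machine k) = {..<2 * k + 5}" "un_states (threshold_machine k) = {}"
  "init_state (threshold_machine k) = 0" "accept_states (threshold_machine k) = {1}"
  "num_symbols (threshold_machine k) = 2" "num_tapes (threshold_machine k) = Suc k"
  "delta (threshold_machine k) = threshold_delta k"
  by (simp_all add: threshold_machine_def)

lemma valid_sweep_action:
  assumes "q < 2 * k + 5" "\<And>i. i \<le> k \<Longrightarrow> s i < 2"
  shows "valid_action (threshold_machine k) (sweep_action k q b m s f)"
  using assms by (auto simp: valid_action_def sweep_action_def states_def simp del: upt_Suc)

lemma sweep_less: "d \<le> k \<Longrightarrow> sweep d g < 2 * k + 5"
  by (simp add: sweep_def)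

lemma threshold_delta_valid:
  assumes q: "q < 2 * k + 5" and ws: "length ws = Suc k" "\<forall>s \<in> set ws. s < 2"
    and act: "act \<in> threshold_delta k q a b ws"
  shows "valid_action (threshold_machine k) act"
proof -
  have sym: "i \<le> k \<Longrightarrow> ws ! i < 2" for i using ws by simp
  consider "q = 0" | "q = 1" | "q = 2" | "3 \<le> q" by linarith
  then show ?thesis
  proof cases
    case 3
    show ?thesis
    proof (cases "ws ! 0 = 0 \<or> (\<forall>i<k. ws ! Suc i \<noteq> 0)")
      case True
      with act 3 sym show ?thesis
        by (auto simp: threshold_delta_def intro!: valid_sweep_action split: if_splits)
    next
      case False
      then obtain i where i: "i < k" "ws ! Suc i = 0" by auto
      have "(LEAST d. ws ! Suc d = 0) \<le> i" using i(2) by (rule Least_le)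
      with False act 3 sym i(1) show ?thesis
        by (auto simp: threshold_delta_def Let_def intro!: valid_sweep_action sweep_less
            split: if_splits)
    qed
  next
    case 4
    then have "(q - 3) div 2 \<le> k" using q by auto
    with 4 act sym show ?thesis
      by (auto simp: threshold_delta_def Let_def intro!: valid_sweep_action sweep_less
          split: option.splits if_splits)
  qed (use act in \<open>auto simp: threshold_delta_def intro!: valid_sweep_action sweep_less\<close>)
qed

lemma random_access_threshold_machine: "random_access_ATM (threshold_machine k)"
  unfolding random_access_ATM_def
  using threshold_delta_valid [of _ k] by (auto simp: states_def threshold_delta_def)

section \<open>Configurations of the threshold machine and its counter\<close>

definition threshold_config :: "nat \<Rightarrow> nat \<Rightarrow> bool list \<Rightarrow> nat \<Rightarrow> (nat \<Rightarrow> nat) \<Rightarrow> config" where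
  "threshold_config k q A h v =
     \<lparr>state = q, addr = A, addr_head = h,
      work = map (\<lambda>i. ((\<lambda>_. 0)(0 := 1), int (v i))) [0..<Suc k]\<rparr>"

lemma threshold_config_simps [simp]:
  "state (threshold_config k q A h v) = q"
  "scan_addr (threshold_config k q A h v) = (if h < length A then Some (A ! h) else None)"
  "scan_work (threshold_config k q A h v) = map (\<lambda>i. if v i = 0 then 1 else 0) [0..<Suc k]"
  "scan_input x (threshold_config k q A h v) =
     (if bits_value A < length x then Some (x ! bits_value A) else None)"
  by (simp_all add: threshold_config_def scan_addr_def scan_work_def scan_input_def addr_value_def
      del: upt_Suc)

text \<open>The first assumption says that scanned symbols are written back, so tape contents stay
  fixed and only head positions change; the second keeps those positions natural numbers.\<close>

lemma apply_sweep_action: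
  assumes "\<And>i. i \<le> k \<Longrightarrow> s i = (if v i = 0 then 1 else 0)"
    and "\<And>i. i \<le> k \<Longrightarrow> move_head (f i) (int (v i)) = int (v' i)"
  shows "apply_action (sweep_action k q b m s f) (threshold_config k q' A h v) =
    threshold_config k q (A[h := b]) (move_addr_head (length A) m h) v'"
  unfolding apply_action_def sweep_action_def threshold_config_def
  by (auto simp: assms zip_map_map zip_same_conv_map fun_eq_iff simp del: upt_Suc)

definition counter_value :: "nat \<Rightarrow> nat \<Rightarrow> (nat \<Rightarrow> nat) \<Rightarrow> nat" where
  "counter_value l k u = (\<Sum>i<k. u i * (l + 1) ^ i)"

text \<open>The full counter is one less than the threshold because it holds the number of ones
  still to be found after the current guess.\<close>

lemma counter_value_max: "Suc (counter_value l k (\<lambda>_. l)) = (l + 1) ^ k"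
  by (induction k) (simp_all add: counter_value_def algebra_simps)

text \<open>A borrow: the lower digits go from 0 to \<open>l\<close>, which adds one less than
  \<open>(l + 1) ^ d\<close> by \<open>counter_value_max\<close>, while digit \<open>d\<close> gives
  up \<open>(l + 1) ^ d\<close>.\<close>

lemma counter_value_decrement:
  assumes "d < k" "0 < u d" "\<And>i. i < d \<Longrightarrow> u i = 0"
  shows "counter_value l k u =
    Suc (counter_value l k (\<lambda>i. if i < d then l else if i = d then u d - 1 else u i))"
proof -
  let ?u' = "\<lambda>i. if i < d then l else if i = d then u d - 1 else u i"
  have eq: "counter_value l k u = Suc (counter_value l k ?u')" if "Suc d \<le> k" for k
    using that
  proof (induction k rule: dec_induct)
    case base
    have "counter_value l d u = 0" by (simp add: counter_value_def assms(3))
    moreover have "counter_value l d ?u' = counter_value l d (\<lambda>_. l)"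
      by (simp add: counter_value_def)
    moreover have "u d * (l + 1) ^ d = (u d - 1) * (l + 1) ^ d + (l + 1) ^ d"
      using assms(2) by (cases "u d") simp_all
    ultimately show ?case
      using counter_value_max [of l d] by (simp add: counter_value_def)
  next
    case (step k)
    then show ?case by (simp add: counter_value_def)
  qed
  show ?thesis using eq [of k] assms(1) by simp
qed

text \<open>The number is a bound on the remaining steps, the proposition characterizes acceptance.\<close>

inductive legit :: "nat \<Rightarrow> bool list \<Rightarrow> nat \<Rightarrow> config \<Rightarrow> nat \<Rightarrow> bool \<Rightarrow> bool"
  for k :: nat and x :: "bool list" and l :: nat where
  start: "legit k x l (init_config (threshold_machine k) x)
    (Suc ((l + 1) ^ k * (2 * l + 2))) ((l + 1) ^ k \<le> ones_from x 0)"
| sweeping: "length A = l \<Longrightarrow> h \<le> l \<Longrightarrow> d \<le> k \<Longrightarrow> (\<And>i. i \<le> d \<Longrightarrow> v i = h) \<Longrightarrow>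
    V = counter_value l k (\<lambda>i. if i < d then l else v (Suc i)) \<Longrightarrow>
    legit k x l (threshold_config k (sweep d g) A h v)
      (V * (2 * l + 2) + (l - h) + l + 2)
      (\<exists>B. length B = l \<and> take h B = take h A \<and> (\<not> g \<longrightarrow> bits_value A < bits_value B) \<and>
         bits_value B < length x \<and> x ! bits_value B \<and> V \<le> ones_from x (Suc (bits_value B)))"
| returning: "length A = l \<Longrightarrow> v 0 = h \<Longrightarrow> h \<le> l \<Longrightarrow> V = counter_value l k (\<lambda>i. v (Suc i)) \<Longrightarrow>
    legit k x l (threshold_config k 2 A h v) (V * (2 * l + 2) + h + 1)
      (V \<le> ones_from x (Suc (bits_value A)))"
| accepted: "state c = 1 \<Longrightarrow> legit k x l c 0 True"

text \<open>From this local condition both correctness and the time bound follow by induction. As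
  the machine is existential, \<open>P\<close> has to act as the disjunction of the promises of the
  successors: none may promise more than \<open>P\<close>, and one must keep it unless the state
  already accepts.\<close>

definition progresses :: "nat \<Rightarrow> bool list \<Rightarrow> nat \<Rightarrow> config \<Rightarrow> nat \<Rightarrow> bool \<Rightarrow> bool" where
  "progresses k x l c m P \<longleftrightarrow>
     (\<forall>c'\<in>successors (threshold_machine k) x c. \<exists>m'<m. \<exists>P'. legit k x l c' m' P' \<and> (P' \<longrightarrow> P)) \<and>
     (P \<longrightarrow> state c = 1 \<or>
        (\<exists>c'\<in>successors (threshold_machine k) x c. \<exists>m'<m. \<exists>P'. legit k x l c' m' P' \<and> P'))"

lemma progresses_singleton:
  assumes "successors (threshold_machine k) x c = {c'}" "legit k x l c' m' P'" "m' < m" "P' \<longleftrightarrow> P"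
  shows "progresses k x l c m P"
proof -
  have "\<exists>m'<m. legit k x l c' m' P" using assms(2-4) by auto
  then show ?thesis unfolding progresses_def assms(1) by blast
qed

section \<open>One step from each kind of configuration\<close>

lemma ex_address:
  assumes "length x \<le> 2 ^ l"
  shows "Suc m \<le> ones_from x a \<longleftrightarrow>
    (\<exists>B. length B = l \<and> a \<le> bits_value B \<and> bits_value B < length x \<and> x ! bits_value B \<and>
       m \<le> ones_from x (Suc (bits_value B)))"
proof
  assume "Suc m \<le> ones_from x a"
  then obtain j where j: "a \<le> j" "j < length x" "x ! j" "m \<le> ones_from x (Suc j)"
    unfolding Suc_le_ones_from by blast
  \<comment> \<open>The hypothesis makes every position expressible with exactly \<open>l\<close>
    bits.\<close>
  obtain B where "length B = l" "bits_value B = j"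
    using ex_bits_value [of j l] j(2) assms by auto
  with j show "\<exists>B. length B = l \<and> a \<le> bits_value B \<and> bits_value B < length x \<and> x ! bits_value B \<and>
      m \<le> ones_from x (Suc (bits_value B))"
    by (intro exI [of _ B]) simp
qed (unfold Suc_le_ones_from, blast)

lemma start_progresses:
  assumes l: "l = addr_length (length x)"
  shows "progresses k x l (init_config (threshold_machine k) x)
    (Suc ((l + 1) ^ k * (2 * l + 2))) ((l + 1) ^ k \<le> ones_from x 0)"
proof -
  let ?A = "replicate l False"
  \<comment> \<open>\<open>sweep k\<close> fills all \<open>k\<close> digits, so the counter starts
    at \<open>(l + 1) ^ k - 1\<close>; the first guess accounts for the missing one.\<close>
  let ?V = "counter_value l k (\<lambda>i. if i < k then l else 0)"
  have V: "Suc ?V = (l + 1) ^ k"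
    using counter_value_max [of l k] by (simp add: counter_value_def)
  \<comment> \<open>The bit written in the first step changes nothing; for \<open>l = 0\<close>
    there is no cell to write to.\<close>
  have "?A[0 := False] = ?A" by (cases l) auto
  then have "apply_action (sweep_action k (sweep k True) False Stay (\<lambda>_. 1) (\<lambda>_. Stay))
      (init_config (threshold_machine k) x) = threshold_config k (sweep k True) ?A 0 (\<lambda>_. 0)"
    by (auto simp: apply_action_def init_config_def sweep_action_def threshold_config_def l
        intro!: nth_equalityI simp del: upt_Suc replicate_Suc)
  then have succ: "successors (threshold_machine k) x (init_config (threshold_machine k) x) =
      {threshold_config k (sweep k True) ?A 0 (\<lambda>_. 0)}"
    by (simp add: successors_def threshold_delta_def init_config_def)
  have "legit k x l (threshold_config k (sweep k True) ?A 0 (\<lambda>_. 0))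
      (?V * (2 * l + 2) + (l - 0) + l + 2)
      (\<exists>B. length B = l \<and> take 0 B = take 0 ?A \<and> (\<not> True \<longrightarrow> bits_value ?A < bits_value B) \<and>
         bits_value B < length x \<and> x ! bits_value B \<and> ?V \<le> ones_from x (Suc (bits_value B)))"
    by (rule legit.sweeping) auto
  from succ this show ?thesis
  proof (rule progresses_singleton)
    \<comment> \<open>A round costs \<open>l\<close> sweeping steps, one check, \<open>l\<close>
      steps back and one decrement, which explains the factor \<open>2 * l + 2\<close>.\<close>
    show "?V * (2 * l + 2) + (l - 0) + l + 2 < Suc ((l + 1) ^ k * (2 * l + 2))"
      unfolding V [symmetric] by (simp add: algebra_simps)
    show "(\<exists>B. length B = l \<and> take 0 B = take 0 ?A \<and> (\<not> True \<longrightarrow> bits_value ?A < bits_value B) \<and>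
         bits_value B < length x \<and> x ! bits_value B \<and> ?V \<le> ones_from x (Suc (bits_value B))) \<longleftrightarrow>
       (l + 1) ^ k \<le> ones_from x 0"
      unfolding V [symmetric]
      using ex_address [of x l ?V 0] le_two_power_addr_length [of "length x"] l by simp
  qed
qed

lemma threshold_delta_sweep:
  "threshold_delta k (sweep d g) a b ws =
    (case b of
       None \<Rightarrow> if g \<and> a = Some True then {sweep_action k 2 False Stay (nth ws) (\<lambda>_. Stay)} else {}
     | Some p \<Rightarrow>
         (\<lambda>r. sweep_action k (sweep d (g \<or> \<not> p \<and> r)) r Move_Right (nth ws)
            (\<lambda>i. if i \<le> d then Move_Right else Stay)) ` {r. g \<or> p \<le> r})"
proof -
  have "sweep d g \<noteq> 0" "sweep d g \<noteq> 1" "sweep d g \<noteq> 2" "(sweep d g - 3) div 2 = d"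
      "odd (sweep d g - 3) = g"
    by (auto simp: sweep_def)
  then show ?thesis
    by (simp only: threshold_delta_def Let_def if_False)
qed

text \<open>The proposition says that the guess made so far extends to a good address
  \<open>B\<close>; choosing a bit splits these \<open>B\<close> by their bit at \<open>h\<close>.
  While \<open>g\<close> is false the sweep has only repeated old bits, so \<open>A\<close> still is
  the old address.\<close>

lemma sweeping_progresses:
  assumes A: "length A = l" and h: "h \<le> l" and d: "d \<le> k" and v: "\<And>i. i \<le> d \<Longrightarrow> v i = h"
    and V: "V = counter_value l k (\<lambda>i. if i < d then l else v (Suc i))"
  shows "progresses k x l (threshold_config k (sweep d g) A h v)
      (V * (2 * l + 2) + (l - h) + l + 2)
      (\<exists>B. length B = l \<and> take h B = take h A \<and> (\<not> g \<longrightarrow> bits_value A < bits_value B) \<and>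
         bits_value B < length x \<and> x ! bits_value B \<and> V \<le> ones_from x (Suc (bits_value B)))"
    (is "progresses k x l ?c ?m (\<exists>B. ?P A h g B)")
proof (cases "h < l")
  case True
  define v' where "v' = (\<lambda>i. if i \<le> d then Suc (v i) else v i)"
  define step where "step = (\<lambda>r. threshold_config k (sweep d (g \<or> \<not> A ! h \<and> r)) (A[h := r]) (Suc h) v')"
  have "apply_action (sweep_action k q r Move_Right (nth (scan_work ?c))
      (\<lambda>i. if i \<le> d then Move_Right else Stay)) ?c = threshold_config k q (A[h := r]) (Suc h) v'" for q r
    using True A by (subst apply_sweep_action [where v' = v']) (auto simp: v'_def simp del: upt_Suc)
  then have succ: "successors (threshold_machine k) x ?c = step ` {r. g \<or> A ! h \<le> r}"
    using True A by (simp add: successors_def threshold_delta_sweep step_def image_image Let_def)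
  have legit: "legit k x l (step r) (V * (2 * l + 2) + (l - Suc h) + l + 2)
      (\<exists>B. ?P (A[h := r]) (Suc h) (g \<or> \<not> A ! h \<and> r) B)" for r
    unfolding step_def
  proof (rule legit.sweeping)
    show "V = counter_value l k (\<lambda>i. if i < d then l else v' (Suc i))"
      unfolding V v'_def counter_value_def by (intro sum.cong) auto
  qed (use True A d v in \<open>auto simp: v'_def\<close>)
  \<comment> \<open>The delicate case is \<open>g\<close> false: raising a bit makes every extension
    larger than \<open>A\<close>, and repeating the old bit leaves \<open>A\<close>
    unchanged.\<close>
  have iff: "?P (A[h := r]) (Suc h) (g \<or> \<not> A ! h \<and> r) B \<longleftrightarrow> ?P A h g B \<and> B ! h = r"
    if r: "g \<or> A ! h \<le> r" for r B
  proof (cases "length B = l")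
    case B: True
    have take: "take (Suc h) B = take (Suc h) (A[h := r]) \<longleftrightarrow> take h B = take h A \<and> B ! h = r"
      using True A B by (simp add: take_Suc_conv_app_nth)
    show ?thesis
    proof (cases "take h B = take h A \<and> B ! h = r \<and> \<not> g")
      case True
      with \<open>h < l\<close> A B have "\<not> A ! h \<Longrightarrow> r \<Longrightarrow> bits_value A < bits_value B"
        by (intro bits_value_less_if_prefix [of A B h]) auto
      moreover have "A[h := r] = A" if "A ! h = r" using that list_update_id [of A h] by simp
      ultimately show ?thesis using True r unfolding take by (cases r; cases "A ! h") auto
    qed (use take in auto)
  qed simp
  \<comment> \<open>Lowering a bit behind equal prefixes would make \<open>B\<close> smaller than
    \<open>A\<close>, so a good \<open>B\<close> always has a permitted bit.\<close>
  have better: "g \<or> A ! h \<le> B ! h" if "?P A h g B" for B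
    using that bits_value_less_if_prefix [of B A h] True A by (cases "A ! h"; cases "B ! h") auto
  show ?thesis
    unfolding progresses_def
  proof (intro conjI ballI impI)
    fix c' assume "c' \<in> successors (threshold_machine k) x ?c"
    then obtain r where "c' = step r" "g \<or> A ! h \<le> r" unfolding succ by blast
    with legit [of r] iff [of r] True
    show "\<exists>m'<?m. \<exists>P'. legit k x l c' m' P' \<and> (P' \<longrightarrow> (\<exists>B. ?P A h g B))"
      by (intro exI [of _ "V * (2 * l + 2) + (l - Suc h) + l + 2"] conjI
          exI [of _ "\<exists>B. ?P (A[h := r]) (Suc h) (g \<or> \<not> A ! h \<and> r) B"]) auto
  next
    assume "\<exists>B. ?P A h g B"
    then obtain B where B: "?P A h g B" by blast
    have "\<exists>c'\<in>successors (threshold_machine k) x ?c. \<exists>m'<?m. \<exists>P'. legit k x l c' m' P' \<and> P'"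
    proof (intro bexI exI conjI)
      show "legit k x l (step (B ! h)) (V * (2 * l + 2) + (l - Suc h) + l + 2)
        (\<exists>B'. ?P (A[h := B ! h]) (Suc h) (g \<or> \<not> A ! h \<and> B ! h) B')" by (rule legit)
      show "\<exists>B'. ?P (A[h := B ! h]) (Suc h) (g \<or> \<not> A ! h \<and> B ! h) B'"
        using iff [OF better [OF B], of B] B by blast
      show "step (B ! h) \<in> successors (threshold_machine k) x ?c"
        unfolding succ using better [OF B] by blast
    qed (use True in simp)
    then show "state ?c = 1 \<or> (\<exists>c'\<in>successors (threshold_machine k) x ?c. \<exists>m'<?m. \<exists>P'. legit k x l c' m' P' \<and> P')"
      by blast
  qed
next
  case False
  with h have h: "h = l" by simp
  \<comment> \<open>At the end of the sweep the heads of the refilled digits have reached position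
    \<open>l\<close>.\<close>
  have val: "counter_value l k (\<lambda>i. v (Suc i)) = V"
    unfolding V counter_value_def using v h by (intro sum.cong) (auto simp: Suc_le_eq)
  show ?thesis
  proof (cases "g \<and> bits_value A < length x \<and> x ! bits_value A")
    case True
    have "apply_action (sweep_action k 2 False Stay (nth (scan_work ?c)) (\<lambda>_. Stay)) ?c =
        threshold_config k 2 A h v"
      using h A by (subst apply_sweep_action [where v' = v]) (auto simp: list_update_beyond simp del: upt_Suc)
    then have succ: "successors (threshold_machine k) x ?c = {threshold_config k 2 A h v}"
      using True h A by (simp add: successors_def threshold_delta_sweep Let_def)
    have "legit k x l (threshold_config k 2 A h v) (V * (2 * l + 2) + h + 1)
        (V \<le> ones_from x (Suc (bits_value A)))"
      by (rule legit.returning) (use A h v val in auto)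
    with succ show ?thesis
      by (rule progresses_singleton) (use True A h in auto)
  next
    case F: False
    have "successors (threshold_machine k) x ?c = {}"
      using F h A by (auto simp: successors_def threshold_delta_sweep Let_def)
    \<comment> \<open>With \<open>h = l\<close> the only candidate for \<open>B\<close> is
      \<open>A\<close>, which does not exceed itself.\<close>
    moreover have "\<not> (\<exists>B. ?P A h g B)" using F h A by auto
    ultimately show ?thesis unfolding progresses_def by blast
  qed
qed

lemma returning_progresses:
  assumes l: "length x \<le> 2 ^ l" and A: "length A = l" and v0: "v 0 = h" and h: "h \<le> l"
    and V: "V = counter_value l k (\<lambda>i. v (Suc i))"
  shows "progresses k x l (threshold_config k 2 A h v) (V * (2 * l + 2) + h + 1)
      (V \<le> ones_from x (Suc (bits_value A)))"
    (is "progresses k x l ?c ?m ?P")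
proof -
  \<comment> \<open>State 2 writes back the scanned bit; past the last cell the update has no
    effect.\<close>
  have upd: "A[h := (h < length A \<and> A ! h)] = A"
    by (cases "h < length A") (auto simp: list_update_beyond)
  have scan: "(scan_addr ?c = Some True) = (h < length A \<and> A ! h)" by simp
  consider (left) "h > 0" | (finished) "h = 0" "\<forall>i<k. v (Suc i) = 0"
    | (continue) "h = 0" "\<exists>i<k. v (Suc i) \<noteq> 0" by blast
  then show ?thesis
  proof cases
    case left
    define v' where "v' = v(0 := h - 1)"
    have "apply_action (sweep_action k 2 (scan_addr ?c = Some True) Move_Left (nth (scan_work ?c))
        (\<lambda>i. if i = 0 then Move_Left else Stay)) ?c = threshold_config k 2 A (h - 1) v'"
      unfolding scan using left v0 upd
      by (subst apply_sweep_action [where v' = v']) (auto simp: v'_def simp del: upt_Suc)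
    then have succ: "successors (threshold_machine k) x ?c = {threshold_config k 2 A (h - 1) v'}"
      using left v0 by (simp add: successors_def threshold_delta_def del: upt_Suc)
    have "legit k x l (threshold_config k 2 A (h - 1) v') (V * (2 * l + 2) + (h - 1) + 1) ?P"
      by (rule legit.returning) (use A h V in \<open>auto simp: v'_def\<close>)
    with succ show ?thesis
      by (rule progresses_singleton) (use left in auto)
  next
    case finished
    define c' where "c' = apply_action (sweep_action k 1 (scan_addr ?c = Some True) Stay
      (nth (scan_work ?c)) (\<lambda>_. Stay)) ?c"
    have succ: "successors (threshold_machine k) x ?c = {c'}"
      using finished v0 unfolding c'_def
      by (simp add: successors_def threshold_delta_def del: upt_Suc)
    \<comment> \<open>No further one is wanted, so the proposition holds trivially and accepting is
      right.\<close>
    have "V = 0" using finished by (simp add: V counter_value_def)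
    have "legit k x l c' 0 True"
      by (rule legit.accepted) (simp add: c'_def apply_action_def sweep_action_def)
    with succ show ?thesis
      by (rule progresses_singleton) (use \<open>V = 0\<close> in auto)
  next
    case continue
    define d where "d = (LEAST d. scan_work ?c ! Suc d = 0)"
    obtain i where i: "i < k" "v (Suc i) \<noteq> 0" using continue by blast
    then have zero: "scan_work ?c ! Suc i = 0" by (simp del: upt_Suc)
    then have "d \<le> i" unfolding d_def by (rule Least_le)
    with i have d: "d < k" by simp
    have "scan_work ?c ! Suc d = 0" unfolding d_def using zero by (rule LeastI)
    with d have vd: "0 < v (Suc d)" by (simp del: upt_Suc split: if_splits)
    have vi: "v (Suc i) = 0" if "i < d" for i
    proof -
      have "scan_work ?c ! Suc i \<noteq> 0"
        using that unfolding d_def by (rule not_less_Least)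
      with that d show ?thesis by (simp del: upt_Suc split: if_splits)
    qed
    define v' where "v' = v(Suc d := v (Suc d) - 1)"
    have "apply_action (sweep_action k q (scan_addr ?c = Some True) Stay (nth (scan_work ?c))
        (\<lambda>i. if i = Suc d then Move_Left else Stay)) ?c = threshold_config k q A 0 v'" for q
      unfolding scan using continue(1) vd upd
      by (subst apply_sweep_action [where v' = v']) (auto simp: v'_def simp del: upt_Suc)
    moreover have "delta (threshold_machine k) 2 (scan_input x ?c) (scan_addr ?c) (scan_work ?c) =
        {sweep_action k (sweep d False) (scan_addr ?c = Some True) Stay (nth (scan_work ?c))
          (\<lambda>i. if i = Suc d then Move_Left else Stay)}"
    proof -
      have "scan_work ?c ! 0 \<noteq> 0" using continue(1) v0 by (simp del: upt_Suc)
      moreover have "\<not> (\<forall>i<k. scan_work ?c ! Suc i \<noteq> 0)" using i(1) zero by blast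
      ultimately show ?thesis by (simp only: threshold_machine_simps threshold_delta_def d_def Let_def) simp
    qed
    ultimately have succ: "successors (threshold_machine k) x ?c = {threshold_config k (sweep d False) A 0 v'}"
      by (simp add: successors_def del: threshold_config_simps(2-) threshold_machine_simps)
    define V' where "V' = counter_value l k (\<lambda>i. if i < d then l else v' (Suc i))"
    have "V = Suc V'"
      unfolding V V'_def v'_def
      by (subst counter_value_decrement [of d]) (use d vd vi in \<open>auto simp: counter_value_def intro!: sum.cong\<close>)
    have "legit k x l (threshold_config k (sweep d False) A 0 v')
        (V' * (2 * l + 2) + (l - 0) + l + 2)
        (\<exists>B. length B = l \<and> take 0 B = take 0 A \<and> (\<not> False \<longrightarrow> bits_value A < bits_value B) \<and>
           bits_value B < length x \<and> x ! bits_value B \<and> V' \<le> ones_from x (Suc (bits_value B)))"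
    proof (rule legit.sweeping)
      \<comment> \<open>The heads that the sweep will move all stand at 0: tape 0 after the return,
        the digits below \<open>d\<close> by minimality of \<open>d\<close>.\<close>
      show "v' i = 0" if "i \<le> d" for i
        using that v0 continue(1) vi by (cases i) (auto simp: v'_def)
    qed (use A d in \<open>auto simp: V'_def\<close>)
    \<comment> \<open>At \<open>h = 0\<close> the prefix condition is void, so the next guess may be
      any one behind \<open>A\<close>, as in \<open>ex_address\<close>.\<close>
    with succ show ?thesis
      by (rule progresses_singleton)
        (use \<open>V = Suc V'\<close> continue(1) ex_address [OF l, of V' "Suc (bits_value A)"] in
          \<open>auto simp: Suc_le_eq\<close>)
  qed
qed

lemma legit_progresses:
  assumes "l = addr_length (length x)" "legit k x l c m P"
  shows "progresses k x l c m P"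
  using assms(2)
proof cases
  case start
  then show ?thesis using start_progresses [OF assms(1)] by simp
next
  case (sweeping A h d v V g)
  show ?thesis unfolding sweeping(1-3) by (rule sweeping_progresses) (use sweeping(4-) in auto)
next
  case (returning A v h V)
  show ?thesis unfolding returning(1-3)
    by (rule returning_progresses) (use returning(4-) assms(1) le_two_power_addr_length in auto)
next
  case accepted
  then show ?thesis by (auto simp: progresses_def successors_def threshold_delta_def)
qed

lemma legit_state: "legit k x l c m P \<Longrightarrow> state c < 2 * k + 5"
  by (erule legit.cases) (auto simp: init_config_def sweep_less)

text \<open>Acceptance means that the proposition survives along some path to state 1; the strictly
  decreasing bound \<open>m\<close> carries the induction.\<close>

lemma legit_accepting_iff:
  assumes l: "l = addr_length (length x)" and "legit k x l c m P"
  shows "accepting (threshold_machine k) x c \<longleftrightarrow> P"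
  using assms(2)
proof (induction m arbitrary: c P rule: less_induct)
  case (less m)
  note prog = legit_progresses [OF l less.prems, unfolded progresses_def]
  show ?case
  proof
    assume "accepting (threshold_machine k) x c"
    then show P
    proof cases
      \<comment> \<open>Only the rule \<open>accepted\<close> covers state 1, and its proposition is
        \<open>True\<close>.\<close>
      case final
      with less.prems show ?thesis
        by cases (auto simp: init_config_def sweep_def)
    next
      case (existential c')
      with prog less.IH show ?thesis by blast
    qed simp
  next
    assume P
    with prog consider "state c = 1"
      | c' m' P' where "c' \<in> successors (threshold_machine k) x c" "m' < m" "legit k x l c' m' P'" P'
      by blast
    then show "accepting (threshold_machine k) x c"
    proof cases
      case 1
      then show ?thesis by (intro accepting.final) simp
    next
      case 2
      with less.IH have "accepting (threshold_machine k) x c'" by blast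
      with 2(1) legit_state [OF less.prems] show ?thesis
        by (intro accepting.existential [of c _ c']) auto
    qed
  qed
qed

lemma legit_steps:
  assumes l: "l = addr_length (length x)" and "legit k x l c m P"
    and "successively (\<lambda>c c'. c' \<in> successors (threshold_machine k) x c) (c # cs)"
  shows "length cs \<le> m \<and> (\<forall>c'\<in>set (c # cs). state c' < 2 * k + 5)"
  using assms(2,3)
proof (induction cs arbitrary: c m P)
  case (Cons c' cs)
  then have "c' \<in> successors (threshold_machine k) x c" by simp
  then obtain m' P' where "m' < m" "legit k x l c' m' P'"
    using legit_progresses [OF l Cons.prems(1)] unfolding progresses_def by blast
  with Cons.IH [of c' m' P'] Cons.prems legit_state [OF Cons.prems(1)] show ?case by auto
qed (simp add: legit_state)

subsection \<open>The separation\<close>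

text \<open>The threshold is the range of a counter with \<open>k\<close> digits in base
  \<open>l + 1\<close>, where \<open>l\<close> is the address length: head positions 0 to
  \<open>l\<close> on \<open>k\<close> tapes count it exactly, while it is of order
  \<open>log^k n\<close>.\<close>

definition threshold_language :: "nat \<Rightarrow> bool list set" where
  "threshold_language k = {x. (addr_length (length x) + 1) ^ k \<le> ones_from x 0}"

lemma accepted_threshold_machine: "accepted_language (threshold_machine k) = threshold_language k"
  using legit_accepting_iff [OF refl legit.start]
  by (auto simp: accepted_language_def threshold_language_def)

lemma threshold_machine_computation:
  assumes "computation (threshold_machine k) x cs"
  shows "num_steps cs \<le> Suc ((addr_length (length x) + 1) ^ k * (2 * addr_length (length x) + 2))"
    and "num_blocks (threshold_machine k) cs \<le> 1"
proof -
  obtain ds where cs: "cs = init_config (threshold_machine k) x # ds"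
    using assms by (cases cs) (auto simp: computation_def)
  have *: "length ds \<le> Suc ((addr_length (length x) + 1) ^ k * (2 * addr_length (length x) + 2)) \<and>
      (\<forall>c\<in>set cs. state c < 2 * k + 5)"
    using assms unfolding cs by (intro legit_steps [OF refl legit.start]) (simp add: computation_def)
  then show "num_steps cs \<le> Suc ((addr_length (length x) + 1) ^ k * (2 * addr_length (length x) + 2))"
    by (simp add: num_steps_def cs)
  have "map (\<lambda>c. state c \<in> ex_states (threshold_machine k)) cs = map (\<lambda>_. True) cs"
    using * by (intro map_cong) auto
  also have "\<dots> = replicate (length cs) True" by (rule map_replicate_const)
  finally show "num_blocks (threshold_machine k) cs \<le> 1"
    by (simp add: num_blocks_def remdups_adj_replicate)
qed

lemma threshold_steps_bigo:
  "(\<lambda>n. real (Suc ((addr_length n + 1) ^ k * (2 * addr_length n + 2)))) \<in> O(\<lambda>n. log 2 (real n) ^ (k + 1))"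
proof (rule bigoI [where c = "2 * 3 ^ (k + 1) + 1"], rule eventually_mono [OF eventually_ge_at_top [of 2]])
  fix n :: nat assume "2 \<le> n"
  then have L: "1 \<le> log 2 (real n)" by (simp add: le_log_iff)
  then have "real (addr_length n) \<le> log 2 (real n) + 1"
    unfolding addr_length_def by linarith
  \<comment> \<open>Rounding up costs at most 1 and the base another 1; both are at most the
    logarithm because \<open>n\<close> is at least 2.\<close>
  with L have "real (addr_length n) + 1 \<le> 3 * log 2 (real n)" by simp
  then have "(real (addr_length n) + 1) ^ (k + 1) \<le> (3 * log 2 (real n)) ^ (k + 1)"
    by (intro power_mono) auto
  moreover have "1 \<le> log 2 (real n) ^ (k + 1)"
    using L by (rule one_le_power)
  moreover have "real (Suc ((addr_length n + 1) ^ k * (2 * addr_length n + 2))) =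
      1 + 2 * (real (addr_length n) + 1) ^ (k + 1)"
    by (simp add: algebra_simps)
  ultimately have "real (Suc ((addr_length n + 1) ^ k * (2 * addr_length n + 2))) \<le>
      (2 * 3 ^ (k + 1) + 1) * log 2 (real n) ^ (k + 1)"
    unfolding power_mult_distrib distrib_right by linarith
  then show "norm (real (Suc ((addr_length n + 1) ^ k * (2 * addr_length n + 2)))) \<le>
      (2 * 3 ^ (k + 1) + 1) * norm (log 2 (real n) ^ (k + 1))"
    using L by (simp only: real_norm_def abs_of_nonneg of_nat_0_le_iff zero_le_power)
qed

text \<open>All states of the machine are existential, so there is a single block and any positive
  \<open>m\<close> will do.\<close>

lemma threshold_language_in_ATIME:
  assumes "1 \<le> m"
  shows "threshold_language k \<in> ATIME (\<lambda>n. log 2 (real n) ^ (k + 1)) m"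
  unfolding ATIME_def
proof (intro CollectI exI conjI allI impI)
  show "init_state (threshold_machine k) \<in> ex_states (threshold_machine k)" by simp
  fix x cs assume "computation (threshold_machine k) x cs"
  note * = threshold_machine_computation [OF this]
  show "num_steps cs \<le> Suc ((addr_length (length x) + 1) ^ k * (2 * addr_length (length x) + 2))"
    by (rule *)
  show "num_blocks (threshold_machine k) cs \<le> m" using *(2) assms by simp
qed (fact random_access_threshold_machine threshold_steps_bigo accepted_threshold_machine)+

lemma threshold_language_not_in_ATIME: "threshold_language k \<notin> ATIME (\<lambda>n. log 2 (real n) ^ k) 2"
proof
  assume "threshold_language k \<in> ATIME (\<lambda>n. log 2 (real n) ^ k) 2"
  then obtain M t where M: "random_access_ATM M" "init_state M \<in> ex_states M"
      and t: "(\<lambda>n. real (t n)) \<in> O(\<lambda>n. log 2 (real n) ^ k)"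
      and bounds: "\<And>x cs. computation M x cs \<Longrightarrow> num_steps cs \<le> t (length x) \<and> num_blocks M cs \<le> 2"
      and lang: "accepted_language M = threshold_language k"
    by (auto simp: ATIME_def)
  obtain c n0 where c: "0 < c" and n0: "\<And>n. n0 \<le> n \<Longrightarrow> real (t n) \<le> c * \<bar>log 2 (real n) ^ k\<bar>"
    using t by (elim landau_o.bigE) (auto simp: eventually_at_top_linorder)
  define a where "a = card (Collect (valid_action M)) + 1"
  \<comment> \<open>\<open>C\<close> is chosen for \<open>t n + 1 <= C * r\<close>, and
    \<open>D\<close> so that \<open>a ^ t n * (t n + 1) ^ r\<close> is then at most
    \<open>(D * r) ^ r\<close>.\<close>
  define C where "C = nat \<lceil>c\<rceil> + 1"
  define D where "D = a ^ C * C"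
  \<comment> \<open>The exponent \<open>2 * k\<close> stands for the square of \<open>r\<close>: the
    contradiction needs \<open>D * r * r < n\<close>.\<close>
  have "eventually (\<lambda>l::nat. real D * (real l + 1) ^ (2 * k) < 2 ^ l) at_top"
    by real_asymp
  then obtain l where l: "n0 \<le> l" "real D * (real l + 1) ^ (2 * k) < 2 ^ l"
    using eventually_happens [OF eventually_conj [OF eventually_ge_at_top [of n0]]] by force
  \<comment> \<open>For a power of two the address length and the logarithm are both exactly
    \<open>l\<close>.\<close>
  define n :: nat where "n = 2 ^ l"
  define r where "r = (l + 1) ^ k"
  have "addr_length n = l"
    by (simp add: addr_length_def n_def log_nat_power)
  have "0 < r" by (simp add: r_def)
  have "0 < D" by (simp add: D_def a_def C_def)
  then have "1 \<le> D" by simp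
  have small: "real D * real r * real r < real n"
    using l(2) by (simp add: r_def n_def power_mult power2_eq_square power_mult_distrib
        mult_2 power_add mult.assoc add.commute)
  \<comment> \<open>This leads to \<open>r <= n\<close>, the condition for the lower bound
    \<open>(n / r) ^ r\<close> on the binomial coefficient.\<close>
  have "real r * 1 \<le> real r * (real D * real r)"
    using \<open>0 < r\<close> \<open>1 \<le> D\<close> by (intro mult_left_mono) (auto simp flip: of_nat_mult)
  with small have "r \<le> n" by (simp add: mult.commute mult.left_commute)
  have "l < n" by (simp add: n_def)
  have "n0 \<le> n" using \<open>l < n\<close> l(1) by simp
  from n0 [OF this] have "real (t n) \<le> c * real l ^ k"
    by (simp add: n_def log_nat_power)
  also have "\<dots> \<le> real (nat \<lceil>c\<rceil>) * real r"
    using c by (intro mult_mono) (auto simp: r_def power_mono of_nat_ceiling)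
  finally have "t n \<le> nat \<lceil>c\<rceil> * r" by (simp flip: of_nat_mult)
  then have T: "t n + 1 \<le> C * r" using \<open>0 < r\<close> by (simp add: C_def)

  interpret two_block_machine M "t n" n
    using M bounds by unfold_locales auto
  have "n choose r \<le> a ^ t n * (t n + 1) ^ r"
    unfolding a_def
  proof (rule threshold_bound)
    fix X assume "X \<subseteq> {..<n}"
    then have "{i. 0 \<le> i \<and> i < length (indicator_word n X) \<and> indicator_word n X ! i} = X" by auto
    then show "indicator_word n X \<in> accepted_language M \<longleftrightarrow> r \<le> card X"
      using \<open>addr_length n = l\<close>
      by (simp add: lang threshold_language_def ones_from_def r_def del: le0)
  qed
  also have "\<dots> \<le> a ^ (C * r) * (C * r) ^ r"
    using T by (intro mult_mono power_increasing power_mono) (auto simp: a_def)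
  also have "\<dots> = (D * r) ^ r"
    by (simp add: D_def power_mult power_mult_distrib)
  finally have "real (n choose r) \<le> real ((D * r) ^ r)" by (simp only: of_nat_le_iff)
  moreover have "(real n / real r) ^ r \<le> real (n choose r)"
    using \<open>r \<le> n\<close> by (rule binomial_ge_n_over_k_pow_k)
  ultimately have "(real n / real r) ^ r \<le> (real D * real r) ^ r" by simp
  \<comment> \<open>Taking \<open>r\<close>-th roots contradicts
    \<open>D * r * r < n\<close>.\<close>
  then have "real n / real r \<le> real D * real r"
    using \<open>0 < r\<close> by (subst (asm) power_mono_iff) auto
  with small \<open>0 < r\<close> show False by (simp add: field_simps)
qed

lemma ATIME_mono:
  assumes "f \<in> O(g)"
  shows "ATIME f m \<subseteq> ATIME g m"
  unfolding ATIME_def using landau_o.big_trans [OF _ assms] by blast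

theorem theorem4:
  fixes k :: nat
  assumes "k > 1"
  shows "ATIME (\<lambda>n. log 2 (real n) ^ k) 2 \<subset> ATIME (\<lambda>n. log 2 (real n) ^ (k + 1)) 2"
proof
  have "(\<lambda>n. log 2 (real n) ^ k) \<in> O(\<lambda>n. log 2 (real n) ^ (k + 1))"
    by real_asymp
  then show "ATIME (\<lambda>n. log 2 (real n) ^ k) 2 \<subseteq> ATIME (\<lambda>n. log 2 (real n) ^ (k + 1)) 2"
    by (rule ATIME_mono)
  show "ATIME (\<lambda>n. log 2 (real n) ^ k) 2 \<noteq> ATIME (\<lambda>n. log 2 (real n) ^ (k + 1)) 2"
    using threshold_language_in_ATIME [of 2 k] threshold_language_not_in_ATIME [of k] by auto
qed


end
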